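(* If $T^{\prime}$ is a subtree of a tree $T$, then $i_{\operatorname{bn}}(T^{\prime})\leq i_{\operatorname{bn}}(T)$.
   Context: A broadcast on a connected graph $G=(V,E)$ is a function $f:V\to\{0,1,\dots,\operatorname{diam}(G)\}$ with $f(v)\le e(v)$ (the eccentricity of $v$) for all $v$ if $|V|\ge 2$, and $f(v)=1$ if $V=\{v\}$; its cost is $\sigma(f)=\sum_v f(v)$ and $V_f^+=\{v:f(v)>0\}$. A vertex $u$ hears $f$ from $v\in V_f^+$ if $d(u,v)\le f(v)$. A broadcast $f$ is bn-independent if every vertex $x$ that hears $f$ from more than one vertex of $V_f^+$ satisfies $d(x,u)\ge f(u)$ for all $u\in V_f^+$; it is maximal bn-independent if it is bn-independent and there is no bn-independent broadcast $g\ne f$ with $g(v)\ge f(v)$ for all $v$. $i_{\operatorname{bn}}(G)$ denotes the minimum cost of a maximal bn-independent broadcast on $G$. *)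

theory Defs
  imports "Graph_Theory.Digraph_Component" "HOL-Library.FuncSet"
begin

text \<open>
  A finite simple graph is a \<^locale>\<open>pair_graph\<close>, that is, a finite irreflexive symmetric arc
  relation. The library constant \<^const>\<open>Digraph_Component.tree\<close> does not describe trees in
  this representation: it counts the closed walk \<open>a, b, a\<close> along a single edge as a cycle.
  Cycles of an undirected simple graph are those of length at least three.
\<close>

definition undirected_tree :: "'a pair_pre_digraph \<Rightarrow> bool" where
  "undirected_tree T \<longleftrightarrow>
     pair_graph T \<and> Digraph_Component.connected (with_proj T) \<and>
     \<not> (\<exists>p. pre_digraph.cycle (with_proj T) p \<and> 3 \<le> length p)"

text \<open>Meaningful only if \<open>u\<close> and \<open>v\<close> are joined by a walk.\<close>

definition gdist :: "'a pair_pre_digraph \<Rightarrow> 'a \<Rightarrow> 'a \<Rightarrow> nat" where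
  "gdist G u v = (LEAST n. \<exists>p. pre_digraph.awalk (with_proj G) u p v \<and> length p = n)"

definition ecc :: "'a pair_pre_digraph \<Rightarrow> 'a \<Rightarrow> nat" where
  "ecc G v = Max (gdist G v ` pverts G)"

definition diam :: "'a pair_pre_digraph \<Rightarrow> nat" where
  "diam G = Max (ecc G ` pverts G)"

text \<open>
  Broadcasts are extensional functions, so that equality of broadcasts is equality on the vertex
  set. On a one-vertex graph the only broadcast has value 1, although the diameter is 0.
\<close>

definition broadcast :: "'a pair_pre_digraph \<Rightarrow> ('a \<Rightarrow> nat) \<Rightarrow> bool" where
  "broadcast G f \<longleftrightarrow>
     (if card (pverts G) = 1 then f \<in> pverts G \<rightarrow>\<^sub>E {1}
      else f \<in> pverts G \<rightarrow>\<^sub>E {0..diam G} \<and> (\<forall>v\<in>pverts G. f v \<le> ecc G v))"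

definition broadcast_cost :: "'a pair_pre_digraph \<Rightarrow> ('a \<Rightarrow> nat) \<Rightarrow> nat" where
  "broadcast_cost G f = (\<Sum>v\<in>pverts G. f v)"

definition broadcasting :: "'a pair_pre_digraph \<Rightarrow> ('a \<Rightarrow> nat) \<Rightarrow> 'a set" where
  "broadcasting G f = {v \<in> pverts G. 0 < f v}"

definition heard_from :: "'a pair_pre_digraph \<Rightarrow> ('a \<Rightarrow> nat) \<Rightarrow> 'a \<Rightarrow> 'a set" where
  "heard_from G f u = {v \<in> broadcasting G f. gdist G u v \<le> f v}"

definition bn_independent :: "'a pair_pre_digraph \<Rightarrow> ('a \<Rightarrow> nat) \<Rightarrow> bool" where
  "bn_independent G f \<longleftrightarrow>
     broadcast G f \<and>
     (\<forall>x\<in>pverts G. 1 < card (heard_from G f x) \<longrightarrow>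
        (\<forall>u\<in>broadcasting G f. f u \<le> gdist G x u))"

definition maximal_bn_independent :: "'a pair_pre_digraph \<Rightarrow> ('a \<Rightarrow> nat) \<Rightarrow> bool" where
  "maximal_bn_independent G f \<longleftrightarrow>
     bn_independent G f \<and>
     \<not> (\<exists>g. bn_independent G g \<and> g \<noteq> f \<and> (\<forall>v\<in>pverts G. f v \<le> g v))"

text \<open>
  On a finite connected graph a maximal bn-independent broadcast exists, since there is a
  bn-independent one (constantly 0, or constantly 1 on a single vertex) and there are only finitely
  many broadcasts; so the minimum below is attained.
\<close>

definition i_bn :: "'a pair_pre_digraph \<Rightarrow> nat" where
  "i_bn G = (LEAST k. \<exists>f. maximal_bn_independent G f \<and> broadcast_cost G f = k)"

end

theory Submission
  imports Defs
begin

text \<open>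
  A broadcast is bn-independent iff \<open>f u + f v \<le> d(u, v)\<close> for distinct broadcasting vertices \<open>u, v\<close>.
  On at least two vertices it is moreover maximal iff every vertex hears it and every broadcasting vertex \<open>v\<close> either
  attains this bound with some \<open>u\<close> or has \<open>f v = e(v)\<close>; the latter forces \<open>v\<close> to be the
  only broadcasting vertex. These conditions only mention the metric, and a subtree is isometrically
  embedded and is reached by deleting leaves one at a time. On deleting a leaf \<open>l\<close> with neighbour
  \<open>w\<close>, restrict \<open>f\<close> if \<open>f l = 0\<close>, and move the value \<open>f l - 1\<close> to \<open>w\<close> if \<open>f l \<ge> 2\<close>. If \<open>f l = 1\<close>,
  then \<open>l\<close> attains the bound with some \<open>u\<^sub>0\<close>, so \<open>w\<close> still hears \<open>u\<^sub>0\<close>; if \<open>u\<^sub>0\<close> no longer attains the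
  bound, the unit of cost freed at \<open>l\<close> is spent at \<open>u\<^sub>0\<close>, unless \<open>u\<^sub>0\<close> already reaches every vertex.
\<close>

section \<open>Finite integer metrics with geodesics, and saturated functions on them\<close>

text \<open>The law \<open>between\<close> makes \<open>d\<close> the path metric of the graph of
  pairs at distance 1. Carrier and distance are separate parameters, so that points can be deleted
  from \<open>S\<close> while \<open>d\<close> stays fixed.\<close>

locale geodesic_space =
  fixes S :: "'a set" and d :: "'a \<Rightarrow> 'a \<Rightarrow> nat"
  assumes finite: "finite S"
    and dist_eq_0_iff: "\<And>x y. x \<in> S \<Longrightarrow> y \<in> S \<Longrightarrow> d x y = 0 \<longleftrightarrow> x = y"
    and dist_commute: "\<And>x y. x \<in> S \<Longrightarrow> y \<in> S \<Longrightarrow> d x y = d y x"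
    and dist_triangle: "\<And>x y z. x \<in> S \<Longrightarrow> y \<in> S \<Longrightarrow> z \<in> S \<Longrightarrow> d x z \<le> d x y + d y z"
    and between: "\<And>x y k. x \<in> S \<Longrightarrow> y \<in> S \<Longrightarrow> k \<le> d x y \<Longrightarrow>
      \<exists>z\<in>S. d x z = k \<and> d z y = d x y - k"

lemma geodesic_space_cong:
  assumes S: "geodesic_space S d" and eq: "\<And>x y. x \<in> S \<Longrightarrow> y \<in> S \<Longrightarrow> d x y = d' x y"
  shows "geodesic_space S d'"
proof -
  interpret geodesic_space S d by fact
  show ?thesis
  proof
    show "finite S" by (rule finite)
  next
    fix x y assume xy: "x \<in> S" "y \<in> S"
    show "d' x y = 0 \<longleftrightarrow> x = y" using dist_eq_0_iff[OF xy] eq[OF xy] by simp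
    show "d' x y = d' y x" using dist_commute[OF xy] eq xy by simp
    show "d' x z \<le> d' x y + d' y z" if "z \<in> S" for z
      using dist_triangle[OF xy that] eq xy that by simp
    fix k assume "k \<le> d' x y"
    then obtain z where "z \<in> S" "d x z = k" "d z y = d x y - k"
      using between[OF xy, of k] eq[OF xy] by auto
    then show "\<exists>z\<in>S. d' x z = k \<and> d' z y = d' x y - k"
      using eq xy by (intro bexI[of _ z]) auto
  qed
qed

definition packing :: "'a set \<Rightarrow> ('a \<Rightarrow> 'a \<Rightarrow> nat) \<Rightarrow> ('a \<Rightarrow> nat) \<Rightarrow> bool" where
  "packing S d f \<longleftrightarrow>
     (\<forall>u\<in>S. \<forall>v\<in>S. u \<noteq> v \<longrightarrow> 0 < f u \<longrightarrow> 0 < f v \<longrightarrow> f u + f v \<le> d u v)"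

definition dominating :: "'a set \<Rightarrow> ('a \<Rightarrow> 'a \<Rightarrow> nat) \<Rightarrow> ('a \<Rightarrow> nat) \<Rightarrow> bool" where
  "dominating S d f \<longleftrightarrow> (\<forall>x\<in>S. \<exists>v\<in>S. 0 < f v \<and> d x v \<le> f v)"

definition touching :: "'a set \<Rightarrow> ('a \<Rightarrow> 'a \<Rightarrow> nat) \<Rightarrow> ('a \<Rightarrow> nat) \<Rightarrow> 'a \<Rightarrow> bool" where
  "touching S d f v \<longleftrightarrow> (\<exists>u\<in>S. u \<noteq> v \<and> 0 < f u \<and> d u v = f u + f v)"

text \<open>The maximum is the eccentricity of \<open>v\<close> relative to
  \<open>S\<close>.\<close>

definition exhausting :: "'a set \<Rightarrow> ('a \<Rightarrow> 'a \<Rightarrow> nat) \<Rightarrow> ('a \<Rightarrow> nat) \<Rightarrow> 'a \<Rightarrow> bool" where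
  "exhausting S d f v \<longleftrightarrow> f v = Max ((\<lambda>u. d u v) ` S)"

definition saturated :: "'a set \<Rightarrow> ('a \<Rightarrow> 'a \<Rightarrow> nat) \<Rightarrow> ('a \<Rightarrow> nat) \<Rightarrow> bool" where
  "saturated S d f \<longleftrightarrow> packing S d f \<and> dominating S d f \<and>
     (\<forall>v\<in>S. 0 < f v \<longrightarrow> touching S d f v \<or> exhausting S d f v)"

text \<open>Broadcasting from \<open>v\<close> alone, with its eccentricity as value, dominates
  \<open>S\<close> and makes \<open>v\<close> exhausting. The second point given by
  \<open>card\<close> keeps this value positive.\<close>

lemma (in geodesic_space) saturated_single:
  assumes v: "v \<in> S" and card: "card S \<noteq> 1"
    and le: "\<And>u. u \<in> S \<Longrightarrow> d u v \<le> c"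
  shows "\<exists>g. saturated S d g \<and> sum g S \<le> c"
proof -
  define e where "e = Max ((\<lambda>u. d u v) ` S)"
  define g where "g = (\<lambda>x. if x = v then e else 0)"
  have ge: "d u v \<le> e" if "u \<in> S" for u
    unfolding e_def using finite that by auto
  obtain u where u: "u \<in> S" "u \<noteq> v"
    using card v by (metis is_singletonI' is_singleton_altdef empty_iff)
  then have "0 < d u v" using dist_eq_0_iff v by auto
  then have pos: "0 < e" using ge u(1) by (meson less_le_trans)
  have "e \<le> c" unfolding e_def using finite v le by (subst Max_le_iff) auto
  moreover have "sum g S = e" unfolding g_def using finite v by simp
  moreover have "saturated S d g"
    unfolding saturated_def packing_def dominating_def exhausting_def
    using v ge pos by (auto simp: g_def e_def[symmetric])
  ultimately show ?thesis by auto
qed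

section \<open>Deletion of a leaf\<close>

text \<open>By \<open>leaf\<close>, the ball of radius \<open>r + 1\<close> about \<open>l\<close>
  meets \<open>S\<close> in the ball of radius \<open>r\<close> about \<open>w\<close>, so
  \<open>w\<close> can stand in for \<open>l\<close> at a value lower by one. For
  \<open>f l = 1\<close> this value would be 0, and a different repair is made.\<close>

lemma saturated_delete_leaf:
  assumes S: "geodesic_space S d" and S': "geodesic_space (insert l S) d"
    and card: "card S \<noteq> 1" and l: "l \<notin> S" and w: "w \<in> S"
    and leaf: "\<And>u. u \<in> S \<Longrightarrow> d u l = d u w + 1"
    and sat: "saturated (insert l S) d f"
  shows "\<exists>g. saturated S d g \<and> sum g S \<le> sum f (insert l S)"
proof -
  interpret geodesic_space S d by fact
  interpret S': geodesic_space "insert l S" d by fact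
  have sum: "sum f (insert l S) = f l + sum f S"
    using finite l by simp
  have le_sum: "f v \<le> sum f (insert l S)" if "v \<in> insert l S" for v
    using S'.finite that by (meson member_le_sum zero_le)
  have pack: "f u + f v \<le> d u v"
    if "u \<in> insert l S" "v \<in> insert l S" "u \<noteq> v" "0 < f u" "0 < f v" for u v
    using sat that unfolding saturated_def packing_def by blast
  have dom: "\<exists>v\<in>insert l S. 0 < f v \<and> d x v \<le> f v" if "x \<in> S" for x
    using sat that unfolding saturated_def dominating_def by blast
  have lw: "d w l = 1" using leaf[OF w] dist_eq_0_iff w by simp
  have dl: "d l u = d u w + 1" if "u \<in> S" for u
    using leaf[OF that] S'.dist_commute that by (metis insertCI)
  show ?thesis
  proof (cases "\<exists>v\<in>insert l S. exhausting (insert l S) d f v")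
    case True
    then obtain v where v: "v \<in> insert l S" and "exhausting (insert l S) d f v" by blast
    then have le: "d u v \<le> f v" if "u \<in> insert l S" for u
      using S'.finite that unfolding exhausting_def by auto
    \<comment> \<open>An exhausting \<open>l\<close> is replaced by \<open>w\<close>, which is
      nearer than \<open>l\<close> to every point of \<open>S\<close>.\<close>
    define v' where "v' = (if v = l then w else v)"
    have "d u v' \<le> sum f (insert l S)" if "u \<in> S" for u
      using le[of u] that leaf[OF that] le_sum[OF v] by (auto simp: v'_def)
    then show ?thesis using saturated_single[of v'] card v w by (auto simp: v'_def)
  next
    case False
    then have touch: "\<exists>u\<in>insert l S. u \<noteq> v \<and> 0 < f u \<and> d u v = f u + f v"
      if "v \<in> insert l S" "0 < f v" for v
      using sat that unfolding saturated_def touching_def by blast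
    consider "f l = 0" | "2 \<le> f l" | "f l = 1" by linarith
    then show ?thesis
    proof cases
      case 1
      have "saturated S d f"
        unfolding saturated_def packing_def dominating_def touching_def
        using pack dom touch 1 by (metis insert_iff less_numeral_extra(3))
      then show ?thesis using sum by auto
    next
      case 2
      have fw: "f w = 0"
      proof (rule ccontr)
        assume "f w \<noteq> 0"
        then have "f w + f l \<le> 1" using pack[OF insertI2[OF w] insertI1] lw l w 2 by force
        then show False using 2 \<open>f w \<noteq> 0\<close> by linarith
      qed
      \<comment> \<open>By \<open>2 \<le> f l\<close> the new value at \<open>w\<close> is positive,
        and by \<open>fw\<close> it overwrites only a 0.\<close>
      define g where "g = f(w := f l - 1)"
      have tw: "\<exists>u\<in>S. u \<noteq> w \<and> 0 < f u \<and> d u w + 1 = f u + f l"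
      proof -
        obtain u where u: "u \<in> insert l S" "u \<noteq> l" "0 < f u" "d u l = f u + f l"
          using touch[OF insertI1] 2 by (metis gr0I not_numeral_le_zero)
        then have "u \<in> S" "u \<noteq> w" using fw by auto
        moreover have "d u w + 1 = f u + f l" using leaf[OF \<open>u \<in> S\<close>] u by linarith
        ultimately show ?thesis using u by blast
      qed
      \<comment> \<open>A vertex that touched \<open>l\<close> now touches \<open>w\<close>:
        distance and value both drop by one.\<close>
      have tv: "\<exists>u\<in>S. u \<noteq> v \<and> 0 < g u \<and> d u v = g u + g v"
        if v: "v \<in> S" "v \<noteq> w" "0 < f v" for v
      proof -
        obtain u where u: "u \<in> insert l S" "u \<noteq> v" "0 < f u" "d u v = f u + f v"
          using touch v by blast
        show ?thesis
        proof (cases "u = l")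
          case True
          then have "d w v + 1 = f l + f v"
            using u v dl dist_commute w by simp
          then show ?thesis using 2 v w by (intro bexI[of _ w]) (auto simp: g_def)
        next
          case False
          then show ?thesis using u v fw by (intro bexI[of _ u]) (auto simp: g_def)
        qed
      qed
      have pw: "f u + (f l - 1) \<le> d u w" if "u \<in> S" "u \<noteq> w" "0 < f u" for u
        using pack[of u l] that leaf[of u] l 2 by fastforce
      have "packing S d g"
        unfolding packing_def g_def using pack pw dist_commute[OF w]
        by (auto simp: add.commute)
      moreover have "dominating S d g"
        unfolding dominating_def
      proof
        fix x assume x: "x \<in> S"
        obtain v where v: "v \<in> insert l S" "0 < f v" "d x v \<le> f v"
          using dom x by blast
        show "\<exists>v\<in>S. 0 < g v \<and> d x v \<le> g v"
        proof (cases "v = l")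
          case True
          then show ?thesis using v w leaf[OF x] 2 by (intro bexI[of _ w]) (auto simp: g_def)
        next
          case False
          then show ?thesis using v fw by (intro bexI[of _ v]) (auto simp: g_def)
        qed
      qed
      moreover have "touching S d g v" if "v \<in> S" "0 < g v" for v
      proof (cases "v = w")
        case True
        obtain u where u: "u \<in> S" "u \<noteq> w" "0 < f u" "d u w + 1 = f u + f l"
          using tw by blast
        then have "d u w = f u + (f l - 1)" using 2 by linarith
        then show ?thesis using u True unfolding touching_def g_def by auto
      next
        case False
        then have "0 < f v" using that by (simp add: g_def)
        then show ?thesis using tv that False unfolding touching_def by blast
      qed
      ultimately have "saturated S d g" unfolding saturated_def by blast
      moreover have "sum g S \<le> sum f (insert l S)"
      proof -
        have "sum g S = f l - 1 + sum g (S - {w})"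
          using finite w by (simp add: sum.remove g_def)
        also have "sum g (S - {w}) = sum f (S - {w})"
          by (rule sum.cong) (auto simp: g_def)
        also have "\<dots> = sum f S" using finite w fw by (simp add: sum.remove)
        finally show ?thesis using sum by simp
      qed
      ultimately show ?thesis by blast
    next
      case 3
      have fw: "f w = 0"
      proof (rule ccontr)
        assume "f w \<noteq> 0"
        then have "f w + f l \<le> 1" using pack[OF insertI2[OF w] insertI1] lw l w 3 by force
        then show False using 3 \<open>f w \<noteq> 0\<close> by linarith
      qed
      \<comment> \<open>A vertex touching \<open>l\<close> has \<open>w\<close> exactly on the
        boundary of its ball, since \<open>f l = 1\<close> cancels the last edge.\<close>
      obtain u0 where u0: "u0 \<in> S" "0 < f u0" "d u0 w = f u0"
      proof -
        obtain u where u: "u \<in> insert l S" "u \<noteq> l" "0 < f u" "d u l = f u + f l"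
          using touch[OF insertI1] 3 by (metis less_one)
        then have "u \<in> S" by simp
        moreover have "d u w = f u" using leaf[OF \<open>u \<in> S\<close>] u 3 by linarith
        ultimately show thesis using that u by blast
      qed
      have domS: "dominating S d f"
        unfolding dominating_def
      proof
        fix x assume x: "x \<in> S"
        obtain v where v: "v \<in> insert l S" "0 < f v" "d x v \<le> f v"
          using dom x by blast
        show "\<exists>v\<in>S. 0 < f v \<and> d x v \<le> f v"
        proof (cases "v = l")
          case True
          \<comment> \<open>Within \<open>S\<close>, the unit ball about \<open>l\<close> contains
            only \<open>w\<close>, which \<open>u0\<close> takes over.\<close>
          then have "x = w" using v leaf[OF x] 3 dist_eq_0_iff[OF x w] by simp
          then show ?thesis using u0 w dist_commute by auto
        next
          case False
          then show ?thesis using v by blast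
        qed
      qed
      have packS: "packing S d f" unfolding packing_def using pack by blast
      \<comment> \<open>The balls of two vertices that touched \<open>l\<close> both reach
        \<open>w\<close>, so the detour through \<open>w\<close> bounds their distance by the sum of
        their values; packing gives the reverse inequality. Thus \<open>u0\<close> replaces
        \<open>l\<close> as partner of any other vertex.\<close>
      have meet: "d v u0 = f v + f u0" if "v \<in> S" "v \<noteq> u0" "0 < f v" "d v l = f v + 1" for v
      proof -
        have "d v u0 \<le> d v w + d w u0" using dist_triangle that w u0 by blast
        moreover have "d v w = f v" using leaf that by simp
        ultimately show ?thesis
          using pack[of v u0] that u0 dist_commute[OF w u0(1)] by auto
      qed
      show ?thesis
      proof (cases "touching S d f u0")
        case True
        have "touching S d f v" if v: "v \<in> S" "0 < f v" for v
        proof (cases "v = u0")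
          case False
          obtain u where u: "u \<in> insert l S" "u \<noteq> v" "0 < f u" "d u v = f u + f v"
            using touch v by blast
          show ?thesis
          proof (cases "u = l")
            case True
            then have "d v u0 = f v + f u0" using u v meet False dl leaf 3 by simp
            then show ?thesis
              unfolding touching_def using False u0 v dist_commute by (metis add.commute)
          next
            case False
            then show ?thesis using u unfolding touching_def by blast
          qed
        qed (use True in simp)
        then have "saturated S d f" unfolding saturated_def using domS packS by blast
        then show ?thesis using sum by auto
      next
        case nt: False
        \<comment> \<open>Nothing in \<open>S\<close> touches \<open>u0\<close>, so by integrality
          every packing inequality at \<open>u0\<close> has slack at least one.\<close>
        have far: "f u + f u0 + 1 \<le> d u u0" if "u \<in> S" "u \<noteq> u0" "0 < f u" for u
          using nt pack[of u u0] that u0 unfolding touching_def by fastforce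
        show ?thesis
        proof (cases "\<forall>x\<in>S. d x u0 \<le> f u0")
          case True
          \<comment> \<open>Here \<open>u0\<close> alone covers \<open>S\<close> at cost at most
            \<open>f u0\<close>, so the other broadcasting vertices are dropped.\<close>
          then have "d x u0 \<le> sum f (insert l S)" if "x \<in> S" for x
            using that le_sum[of u0] u0(1) by fastforce
          then show ?thesis using saturated_single[OF u0(1) card] by blast
        next
          case False
          define g where "g = f(u0 := f u0 + 1)"
          have "packing S d g"
            unfolding packing_def g_def using pack far dist_commute[OF u0(1)]
            by (auto simp: ac_simps)
          moreover have "dominating S d g"
            using domS u0 unfolding dominating_def g_def by (fastforce split: if_splits)
          moreover have "touching S d g v" if v: "v \<in> S" "0 < g v" for v
          proof (cases "v = u0")
            case True
            obtain x where "x \<in> S" "f u0 + 1 \<le> d u0 x"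
              using \<open>\<not> (\<forall>x\<in>S. _ x)\<close> dist_commute[OF u0(1)] by fastforce
            \<comment> \<open>The point \<open>z\<close> lies just outside the old ball of
              \<open>u0\<close>, so another vertex \<open>u\<close> dominates it. The triangle
              inequality then limits the slack between \<open>u\<close> and \<open>u0\<close> to
              one, which the raise at \<open>u0\<close> uses up.\<close>
            then obtain z where z: "z \<in> S" "d u0 z = f u0 + 1"
              using between[OF u0(1)] by blast
            then obtain u where u: "u \<in> S" "0 < f u" "d z u \<le> f u"
              using domS unfolding dominating_def by blast
            have "u \<noteq> u0" using u z dist_commute[OF u0(1) z(1)] by auto
            moreover have "d u u0 \<le> f u + (f u0 + 1)"
              using dist_triangle[OF u0(1) z(1) u(1)] z u dist_commute[OF u0(1) u(1)] by simp
            ultimately show ?thesis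
              using far[of u] u True unfolding touching_def g_def by fastforce
          next
            case False
            then have fv: "0 < f v" using v by (simp add: g_def)
            obtain u where u: "u \<in> insert l S" "u \<noteq> v" "0 < f u" "d u v = f u + f v"
              using touch v fv by blast
            \<comment> \<open>By \<open>meet\<close>, a vertex that touched \<open>l\<close> would
              touch \<open>u0\<close>, contrary to \<open>far\<close>. With \<open>u0\<close>
              excluded as well, the old partner lies in \<open>S\<close> and keeps its
              value.\<close>
            have "u \<noteq> l" using meet[of v] far[of v] u v fv False dl leaf 3 by auto
            moreover have "u \<noteq> u0"
              using far[OF v(1) False fv] u dist_commute[OF u0(1) v(1)] by auto
            ultimately show ?thesis
              using u False unfolding touching_def g_def by auto
          qed
          ultimately have "saturated S d g" unfolding saturated_def by blast
          moreover have "sum g S \<le> sum f (insert l S)"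
          proof -
            have "sum g S = f u0 + 1 + sum g (S - {u0})"
              using finite u0 by (simp add: sum.remove g_def)
            also have "sum g (S - {u0}) = sum f (S - {u0})"
              by (rule sum.cong) (auto simp: g_def)
            also have "f u0 + 1 + \<dots> = sum f S + 1" using finite u0 by (simp add: sum.remove)
            finally show ?thesis using sum 3 by simp
          qed
          ultimately show ?thesis by blast
        qed
      qed
    qed
  qed
qed

section \<open>Geodesic subspaces of tree metrics\<close>

text \<open>The metric laws are inherited from \<open>V\<close>. For \<open>between\<close>, a
  geodesic to \<open>l\<close> is a geodesic to \<open>w\<close> extended by one edge.\<close>

lemma geodesic_space_insert_leaf:
  assumes V: "geodesic_space V d" and S: "geodesic_space S d" and sub: "insert l S \<subseteq> V"
    and w: "w \<in> S" and leaf: "\<And>u. u \<in> S \<Longrightarrow> d u l = d u w + 1"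
  shows "geodesic_space (insert l S) d"
proof -
  interpret V: geodesic_space V d by fact
  interpret S: geodesic_space S d by fact
  have dl: "d l u = d u w + 1" if "u \<in> S" for u
    using leaf[OF that] V.dist_commute that sub by (metis insert_subset subsetD)
  have ll: "d l l = 0" using V.dist_eq_0_iff sub by simp
  have to: "\<exists>z\<in>insert l S. d x z = k \<and> d z l = d x l - k" if x: "x \<in> S" and k: "k \<le> d x l" for x k
  proof (cases "k = d x l")
    case False
    then have "k \<le> d x w" using k leaf[OF x] by simp
    then obtain z where z: "z \<in> S" "d x z = k" "d z w = d x w - k"
      using S.between[OF x w] by blast
    have "d z l = d x l - k"
      using leaf[OF x] leaf[OF z(1)] z(3) \<open>k \<le> d x w\<close> by linarith
    then show ?thesis using z by blast
  qed (use ll in auto)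
  have betw: "\<exists>z\<in>insert l S. d x z = k \<and> d z y = d x y - k"
    if xy: "x \<in> insert l S" "y \<in> insert l S" and k: "k \<le> d x y" for x y k
  proof (cases "x = l")
    case True
    show ?thesis
    proof (cases "y = l")
      case False
      then have y: "y \<in> S" using xy by simp
      have "d y l = d x y" using True dl[OF y] leaf[OF y] by simp
      \<comment> \<open>A geodesic starting at \<open>l\<close> is read backwards from
        \<open>y\<close>, hence the complementary parameter \<open>d x y - k\<close>.\<close>
      then obtain z where z: "z \<in> insert l S" "d y z = d x y - k" "d z l = k"
        using to[OF y, of "d x y - k"] k by (metis diff_diff_cancel diff_le_self)
      then have "d x z = k" "d z y = d x y - k"
        using True y sub V.dist_commute by (metis insert_subset subsetD)+
      then show ?thesis using z by blast
    qed (use True k ll in auto)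
  next
    case False
    then show ?thesis
      using to S.between xy k by (cases "y = l") (fastforce, metis insert_iff)
  qed
  show ?thesis
  proof
    show "finite (insert l S)" using S.finite by simp
  next
    fix x y assume "x \<in> insert l S" "y \<in> insert l S"
    then have xy: "x \<in> V" "y \<in> V" using sub by auto
    show "d x y = 0 \<longleftrightarrow> x = y" using V.dist_eq_0_iff[OF xy] .
    show "d x y = d y x" using V.dist_commute[OF xy] .
    fix z assume "z \<in> insert l S"
    then show "d x z \<le> d x y + d y z" using V.dist_triangle[OF xy] sub by blast
  qed (rule betw)
qed

text \<open>Seen from any root \<open>u\<close>, no edge joins two vertices of the same level, and
  each vertex has at most one neighbour one level closer to the root: acyclicity expressed by
  distances alone.\<close>

locale tree_metric = geodesic_space V d for V :: "'a set" and d +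
  assumes bipartite: "\<And>a b u. a \<in> V \<Longrightarrow> b \<in> V \<Longrightarrow> u \<in> V \<Longrightarrow> d a b = 1 \<Longrightarrow> d u a \<noteq> d u b"
    and parent_unique: "\<And>a b c u. a \<in> V \<Longrightarrow> b \<in> V \<Longrightarrow> c \<in> V \<Longrightarrow> u \<in> V \<Longrightarrow>
      d a c = 1 \<Longrightarrow> d b c = 1 \<Longrightarrow> d u c = d u a + 1 \<Longrightarrow> d u c = d u b + 1 \<Longrightarrow> a = b"
begin

text \<open>The point \<open>l\<close> becomes a leaf of \<open>insert l S\<close>, not necessarily
  of \<open>V\<close>. By parity \<open>d u l\<close> and \<open>d u w\<close> differ by one. Were
  \<open>l\<close> the nearer to \<open>u\<close>, it would be the only parent of \<open>w\<close>
  seen from \<open>u\<close>, but a geodesic inside \<open>S\<close> supplies a parent in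
  \<open>S\<close>.\<close>

lemma obtain_leaf:
  assumes S: "geodesic_space S d" and sub: "S \<subset> V" and ne: "S \<noteq> {}"
  obtains l w where "l \<in> V" "l \<notin> S" "w \<in> S" "\<And>u. u \<in> S \<Longrightarrow> d u l = d u w + 1"
proof -
  interpret S: geodesic_space S d by fact
  obtain s where s: "s \<in> S" using ne by blast
  then have sV: "s \<in> V" using sub by blast
  \<comment> \<open>Minimality of the distance from \<open>s\<close> forces the vertex before
    \<open>l\<close> on a geodesic from \<open>s\<close> into \<open>S\<close>.\<close>
  obtain l where l: "l \<in> V - S" and min: "\<And>x. x \<in> V - S \<Longrightarrow> d s l \<le> d s x"
    using ex_min_if_finite[of "d s ` (V - S)"] sub finite
    by (metis arg_min_if_finite(1,2) finite_Diff Diff_eq_empty_iff not_less psubset_eq subset_antisym)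
  have "0 < d s l" using l s sub dist_eq_0_iff[OF sV] by auto
  then obtain w where w: "w \<in> V" "d s w = d s l - 1" "d w l = 1"
    using between[OF sV, of l "d s l - 1"] l by fastforce
  have wS: "w \<in> S" using min[of w] w \<open>0 < d s l\<close> by fastforce
  have "d u l = d u w + 1" if u: "u \<in> S" for u
  proof (rule ccontr)
    assume neq: "d u l \<noteq> d u w + 1"
    have uV: "u \<in> V" and lV: "l \<in> V" using u sub l by auto
    have "d u l \<le> d u w + 1" "d u w \<le> d u l + 1"
      using dist_triangle[OF uV w(1) lV] dist_triangle[OF uV lV w(1)] w(3)
        dist_commute[OF w(1) lV] by auto
    moreover have "d u w \<noteq> d u l" using bipartite[OF w(1) lV uV w(3)] by simp
    ultimately have down: "d u w = d u l + 1" using neq by simp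
    then obtain z where z: "z \<in> S" "d u z = d u w - 1" "d z w = 1"
      using S.between[OF u wS, of "d u w - 1"] by fastforce
    then have "z = l"
      using parent_unique[of z l w u] down sub lV w uV dist_commute[OF w(1) lV] by auto
    then show False using z l by blast
  qed
  then show thesis using that l wS by blast
qed

text \<open>Induction on the number of missing points: the function is first brought from
  \<open>V\<close> down to \<open>insert l S\<close>, and then \<open>l\<close> is deleted.\<close>

lemma saturated_restrict:
  assumes "geodesic_space S d" "S \<subseteq> V" "S \<noteq> {}" "card S \<noteq> 1" "saturated V d f"
  shows "\<exists>g. saturated S d g \<and> sum g S \<le> sum f V"
  using assms(1-4)
proof (induction "card (V - S)" arbitrary: S rule: less_induct)
  case less
  show ?case
  proof (cases "S = V")
    case True
    then show ?thesis using assms(5) by blast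
  next
    case False
    then obtain l w where l: "l \<in> V" "l \<notin> S" and w: "w \<in> S"
      and leaf: "\<And>u. u \<in> S \<Longrightarrow> d u l = d u w + 1"
      using obtain_leaf less.prems by (metis psubsetI)
    have S': "geodesic_space (insert l S) d"
      using geodesic_space_insert_leaf[of V d S l w] geodesic_space_axioms less.prems l w leaf by blast
    have finS: "finite S" using finite less.prems finite_subset by blast
    have "card (insert l S) \<noteq> 1" using l finS less.prems by auto
    moreover have "card (V - insert l S) < card (V - S)"
      using finite l by (intro psubset_card_mono) auto
    ultimately obtain g where g: "saturated (insert l S) d g" "sum g (insert l S) \<le> sum f V"
      using less.hyps[of "insert l S"] S' less.prems l by auto
    then show ?thesis
      using saturated_delete_leaf[OF less.prems(1) S' less.prems(4) l(2) w leaf] by (meson le_trans)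
  qed
qed

end

section \<open>Distances in connected graphs\<close>

locale connected_pair_graph = pair_graph G for G +
  assumes connected: "Digraph_Component.connected (with_proj G)"
begin

lemma awalk_exists:
  assumes "u \<in> pverts G" "v \<in> pverts G"
  shows "\<exists>p. awalk u p v"
proof -
  \<comment> \<open>\<open>connected\<close> concerns the symmetric closure; the arcs are symmetric
    already, so walks exist in \<open>G\<close> itself.\<close>
  have "strongly_connected (with_proj G)"
    using symmetric_connected_imp_strongly_connected[OF pair_sym_arcs connected] .
  then show ?thesis
    using assms by (auto simp: strongly_connected_def reachable_awalk)
qed

lemma gdist_le: "awalk u p v \<Longrightarrow> gdist G u v \<le> length p"
  unfolding gdist_def by (rule Least_le) auto

lemma shortest_awalk:
  assumes "u \<in> pverts G" "v \<in> pverts G"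
  obtains p where "awalk u p v" "length p = gdist G u v"
proof -
  obtain p where "awalk u p v" using awalk_exists assms by blast
  then have "\<exists>n p. awalk u p v \<and> length p = n" by blast
  then have "\<exists>p. awalk u p v \<and> length p = gdist G u v"
    unfolding gdist_def by (rule LeastI_ex)
  then show thesis using that by blast
qed

lemma gdist_triangle:
  assumes "u \<in> pverts G" "v \<in> pverts G" "w \<in> pverts G"
  shows "gdist G u w \<le> gdist G u v + gdist G v w"
proof -
  obtain p where p: "awalk u p v" "length p = gdist G u v" using shortest_awalk[OF assms(1,2)] .
  obtain q where q: "awalk v q w" "length q = gdist G v w" using shortest_awalk[OF assms(2,3)] .
  show ?thesis using gdist_le[OF awalk_appendI[OF p(1) q(1)]] p q by simp
qed

lemma gdist_commute:
  assumes "u \<in> pverts G" "v \<in> pverts G"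
  shows "gdist G u v = gdist G v u"
proof -
  have len: "length (rev_path p) = length p" for p :: "('a \<times> 'a) list"
    by (induction p) auto
  have "gdist G y x \<le> gdist G x y" if xy: "x \<in> pverts G" "y \<in> pverts G" for x y
  proof -
    obtain p where "awalk x p y" "length p = gdist G x y" using shortest_awalk[OF xy] .
    then show ?thesis using gdist_le[of y "rev_path p" x] by (simp add: len)
  qed
  then show ?thesis using assms by (simp add: le_antisym)
qed

lemma geodesic_space_gdist: "geodesic_space (pverts G) (gdist G)"
proof
  show "finite (pverts G)" by (rule pair_finite_verts)
next
  fix x y assume xy: "x \<in> pverts G" "y \<in> pverts G"
  obtain p where p: "awalk x p y" "length p = gdist G x y" using shortest_awalk[OF xy] .
  show "gdist G x y = 0 \<longleftrightarrow> x = y"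
  proof
    assume "gdist G x y = 0"
    then show "x = y" using p by (simp add: awalk_Nil_iff)
  next
    assume "x = y"
    then show "gdist G x y = 0" using gdist_le[of x "[]" y] xy by (simp add: awalk_Nil_iff)
  qed
  show "gdist G x y = gdist G y x" by (rule gdist_commute[OF xy])
  show "gdist G x z \<le> gdist G x y + gdist G y z" if "z \<in> pverts G" for z
    by (rule gdist_triangle[OF xy that])
  fix k assume k: "k \<le> gdist G x y"
  \<comment> \<open>A shortest walk is cut after \<open>k\<close> arcs; by the triangle inequality
    both pieces are shortest.\<close>
  define z where "z = awlast x (take k p)"
  have "awalk x (take k p @ drop k p) y" using p by simp
  then have w: "awalk x (take k p) z" "awalk z (drop k p) y"
    unfolding awalk_append_iff z_def by auto
  then have z: "z \<in> pverts G" by (rule_tac awalk_last_in_verts)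
  show "\<exists>z\<in>pverts G. gdist G x z = k \<and> gdist G z y = gdist G x y - k"
    using gdist_le[OF w(1)] gdist_le[OF w(2)] gdist_triangle[OF xy(1) z xy(2)] p k z
    by (intro bexI[of _ z]) auto
qed

end

section \<open>Non-backtracking walks in trees\<close>

text \<open>The walk with arcs \<open>(a, b), (b, c)\<close> backtracks iff \<open>a = c\<close>.\<close>

abbreviation non_backtracking :: "('a \<times> 'a) list \<Rightarrow> bool" where
  "non_backtracking \<equiv> successively (\<lambda>e f. fst e \<noteq> snd f)"

lemma non_backtracking_rev_path: "non_backtracking (rev_path p) \<longleftrightarrow> non_backtracking p"
proof (induction p)
  case (Cons e es)
  have "last (rev_path es) = (snd (hd es), fst (hd es))" if "es \<noteq> []"
    using that by (cases es) auto
  then show ?case using Cons by (auto simp: successively_append_iff successively_Cons)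
qed simp

lemma not_successively_decomp:
  "\<not> successively P xs \<Longrightarrow> \<exists>ys x y zs. xs = ys @ x # y # zs \<and> \<not> P x y"
proof (induction P xs rule: successively.induct)
  case (3 P x y xs)
  show ?case
  proof (cases "P x y")
    case True
    then obtain ys a b zs where "y # xs = ys @ a # b # zs" "\<not> P a b" using 3 by auto
    then have "x # y # xs = (x # ys) @ a # b # zs" by simp
    then show ?thesis using \<open>\<not> P a b\<close> by blast
  qed blast
qed simp_all

text \<open>Cutting out an arc and its reversal leaves a walk shorter by two.\<close>

lemma (in connected_pair_graph) shortest_non_backtracking:
  assumes p: "awalk u p v" and len: "length p = gdist G u v"
  shows "non_backtracking p"
proof (rule ccontr)
  assume "\<not> non_backtracking p"
  then obtain q e f r where q: "p = q @ e # f # r" and ef: "fst e = snd f"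
    using not_successively_decomp[of _ p] by blast
  have "awalk u q (fst e)" "awalk (snd f) r v"
    using p unfolding q awalk_append_iff awalk_Cons_iff by auto
  then have "awalk u (q @ r) v" unfolding ef by (rule awalk_appendI)
  then have "gdist G u v \<le> length (q @ r)" by (rule gdist_le)
  then show False using len q by simp
qed

locale tree_graph = connected_pair_graph +
  assumes no_cycle: "cycle p \<Longrightarrow> length p < 3"
begin

text \<open>A nonempty walk of this kind either is a cycle, hence of length at most two and so a
  loop or a backtrack, or contains a shorter nonempty closed walk.\<close>

lemma closed_non_backtracking:
  assumes "awalk u p u" "non_backtracking p"
  shows "p = []"
  using assms
proof (induction "length p" arbitrary: u p rule: less_induct)
  case less
  show ?case
  proof (rule ccontr)
    assume "p \<noteq> []"
    then obtain e es where p: "p = e # es" by (cases p) auto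
    show False
    proof (cases "distinct (tl (awalk_verts u p))")
      case True
      then have "cycle p" using less.prems \<open>p \<noteq> []\<close> unfolding cycle_def by blast
      then have "length p < 3" by (rule no_cycle)
      then consider "es = []" | f where "es = [f]" using p by (cases es) auto
      then show False
      proof cases
        case 1
        then show False using less.prems p pair_no_loops[of e] by (auto simp: awalk_simps)
      next
        case 2
        then show False using less.prems p by (auto simp: awalk_simps)
      qed
    next
      case False
      then have *: "awalk (snd e) es u" "\<not> distinct (awalk_verts (snd e) es)"
        using less.prems p by (auto simp: awalk_Cons_iff)
      obtain q r s w where r: "es = q @ r @ s" "0 < length r" "awalk w r w"
        using awalk_not_distinct_decomp[OF *] by blast
      \<comment> \<open>The condition ignores the seam of a closed walk, so contiguous segments
        inherit it.\<close>
      then have "non_backtracking r"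
        using less.prems p by (auto simp: successively_append_iff successively_Cons)
      then show False using less.hyps[of r w] r p by auto
    qed
  qed
qed

text \<open>Equal last arcs are stripped. If the last arcs differ, one walk followed by the reverse
  of the other is a nonempty closed walk that does not backtrack.\<close>

lemma non_backtracking_unique:
  assumes "awalk u p v" "non_backtracking p" "awalk u q v" "non_backtracking q"
  shows "p = q"
  using assms
proof (induction p arbitrary: q v rule: rev_induct)
  case Nil
  then show ?case using closed_non_backtracking[of u q] by (auto simp: awalk_Nil_iff)
next
  case (snoc e p)
  show ?case
  proof (cases q rule: rev_exhaust)
    case Nil
    then show ?thesis
      using snoc.prems closed_non_backtracking[of u "p @ [e]"] by (auto simp: awalk_Nil_iff)
  next
    case (snoc q' f)
    have pe: "awalk u p (fst e)" "snd e = v" and qf: "awalk u q' (fst f)" "snd f = v"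
      using \<open>awalk u (p @ [e]) v\<close> \<open>awalk u q v\<close> unfolding snoc awalk_append_iff awalk_simps
      by auto
    have nb: "non_backtracking p" "non_backtracking q'"
      using \<open>non_backtracking (p @ [e])\<close> \<open>non_backtracking q\<close> snoc
      by (auto simp: successively_append_iff)
    show ?thesis
    proof (cases "fst e = fst f")
      case True
      then show ?thesis using snoc.IH[OF pe(1) nb(1) _ nb(2)] qf pe snoc by (simp add: prod_eq_iff)
    next
      case False
      have "awalk u ((p @ [e]) @ rev_path q) u"
        using \<open>awalk u (p @ [e]) v\<close> \<open>awalk u q v\<close> by (metis awalk_appendI awalk_rev_path)
      \<comment> \<open>At the junction \<open>e\<close> is followed by the reversal of
        \<open>f\<close>, which backtracks only if \<open>fst e = fst f\<close>.\<close>
      moreover have "non_backtracking ((p @ [e]) @ rev_path q)"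
        unfolding successively_append_iff[of _ "p @ [e]"] non_backtracking_rev_path
        using \<open>non_backtracking (p @ [e])\<close> \<open>non_backtracking q\<close> snoc False by simp
      ultimately show ?thesis using closed_non_backtracking by blast
    qed
  qed
qed

lemma gdist_eq_1_imp_arc:
  assumes "a \<in> pverts G" "b \<in> pverts G" "gdist G a b = 1"
  shows "(a, b) \<in> parcs G"
proof -
  obtain p where "awalk a p b" "length p = 1" using shortest_awalk[OF assms(1,2)] assms(3) by metis
  then show ?thesis by (auto simp: length_Suc_conv awalk_simps)
qed

text \<open>Shortest walks do not backtrack, so by uniqueness the given walk is a shortest
  one.\<close>

lemma length_non_backtracking:
  assumes "awalk u p v" "non_backtracking p"
  shows "length p = gdist G u v"
proof -
  have "u \<in> pverts G" "v \<in> pverts G"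
    using assms awalk_hd_in_verts awalk_last_in_verts by blast+
  then obtain q where "awalk u q v" "length q = gdist G u v" using shortest_awalk by blast
  then show ?thesis
    using non_backtracking_unique[OF assms] shortest_non_backtracking by force
qed

text \<open>Both laws come from appending an arc to a shortest walk. For adjacent equidistant
  \<open>a\<close> and \<open>b\<close> the extended walk would not backtrack, yet be one longer
  than the distance. Two distinct parents of \<open>c\<close> would give shortest walks to
  \<open>c\<close> with different last arcs.\<close>

lemma tree_metric_gdist: "tree_metric (pverts G) (gdist G)"
  proof (rule tree_metric.intro[OF geodesic_space_gdist tree_metric_axioms.intro])
    fix a b u assume V: "a \<in> pverts G" "b \<in> pverts G" "u \<in> pverts G" and ab: "gdist G a b = 1"
    obtain p where p: "awalk u p a" "length p = gdist G u a"
      using shortest_awalk[OF V(3,1)] .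
    show "gdist G u a \<noteq> gdist G u b"
    proof
      assume eq: "gdist G u a = gdist G u b"
      \<comment> \<open>A last arc coming from \<open>b\<close> would put \<open>b\<close> nearer to
        \<open>u\<close> than \<open>a\<close>.\<close>
      have "fst (last p) \<noteq> b" if "p \<noteq> []"
      proof
        assume b: "fst (last p) = b"
        have "awalk u (butlast p @ [last p]) a" using p that by simp
        then have "awalk u (butlast p) b" unfolding awalk_append_iff awalk_simps using b by auto
        then show False using gdist_le[of u "butlast p" b] p eq that
          by (metis diff_less length_butlast length_greater_0_conv less_numeral_extra(1) not_le)
      qed
      then have "non_backtracking (p @ [(a, b)])"
        using shortest_non_backtracking[OF p] by (auto simp: successively_append_iff)
      moreover have "awalk u (p @ [(a, b)]) b"
        by (rule awalk_appendI[OF p(1)])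
          (use gdist_eq_1_imp_arc[OF V(1,2) ab] V in \<open>simp add: awalk_simps\<close>)
      ultimately have "length (p @ [(a, b)]) = gdist G u b" by (intro length_non_backtracking)
      then show False using p eq by simp
    qed
  next
    fix a b c u
    assume V: "a \<in> pverts G" "b \<in> pverts G" "c \<in> pverts G" "u \<in> pverts G"
      and ac: "gdist G a c = 1" and bc: "gdist G b c = 1"
      and da: "gdist G u c = gdist G u a + 1" and db: "gdist G u c = gdist G u b + 1"
    have ex: "\<exists>p. awalk u (p @ [(x, c)]) c \<and> non_backtracking (p @ [(x, c)])"
      if x: "x \<in> pverts G" "gdist G x c = 1" "gdist G u c = gdist G u x + 1" for x
    proof -
      obtain p where p: "awalk u p x" "length p = gdist G u x"
        using shortest_awalk[OF V(4) x(1)] .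
      then have "awalk u (p @ [(x, c)]) c"
        by (intro awalk_appendI[OF p(1)])
          (use gdist_eq_1_imp_arc[OF x(1) V(3) x(2)] V in \<open>simp add: awalk_simps\<close>)
      moreover from this have "non_backtracking (p @ [(x, c)])"
        by (rule shortest_non_backtracking) (use p x in simp)
      ultimately show ?thesis by blast
    qed
    obtain p where p: "awalk u (p @ [(a, c)]) c" "non_backtracking (p @ [(a, c)])"
      using ex[OF V(1) ac da] by (elim exE conjE)
    obtain q where q: "awalk u (q @ [(b, c)]) c" "non_backtracking (q @ [(b, c)])"
      using ex[OF V(2) bc db] by (elim exE conjE)
    have "p @ [(a, c)] = q @ [(b, c)]" by (rule non_backtracking_unique[OF p q])
    then show "a = b" by simp
  qed

text \<open>Backtracking depends on the list of arcs alone, so a shortest walk of \<open>H\<close>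
  does not backtrack in \<open>G\<close> either and has the length of the distance there.\<close>

lemma gdist_subgraph:
  assumes H: "connected_pair_graph H" and sub: "subgraph (with_proj H) (with_proj G)"
    and uv: "u \<in> pverts H" "v \<in> pverts H"
  shows "gdist H u v = gdist G u v"
proof -
  interpret H: connected_pair_graph H by fact
  obtain p where p: "H.awalk u p v" "length p = gdist H u v" using H.shortest_awalk[OF uv] .
  have "awalk u p v" using subgraph_awalk_imp_awalk[OF p(1) sub] .
  then show ?thesis
    using length_non_backtracking H.shortest_non_backtracking[OF p] p(2) by simp
qed

end

section \<open>Maximal bn-independent broadcasts as saturated functions\<close>

context connected_pair_graph
begin

interpretation M: geodesic_space "pverts G" "gdist G" by (rule geodesic_space_gdist)

lemma pverts_nonempty: "pverts G \<noteq> {}"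
  using connected by (auto simp: Digraph_Component.connected_def strongly_connected_def mk_symmetric_def)

lemma gdist_le_ecc: "u \<in> pverts G \<Longrightarrow> v \<in> pverts G \<Longrightarrow> gdist G v u \<le> ecc G v"
  unfolding ecc_def using M.finite by simp

lemma ecc_le_diam: "v \<in> pverts G \<Longrightarrow> ecc G v \<le> diam G"
  unfolding diam_def using M.finite by simp

lemma exhausting_iff_ecc:
  assumes "v \<in> pverts G"
  shows "exhausting (pverts G) (gdist G) f v \<longleftrightarrow> f v = ecc G v"
proof -
  have "(\<lambda>u. gdist G u v) ` pverts G = gdist G v ` pverts G"
    using M.dist_commute assms by (intro image_cong) auto
  then show ?thesis unfolding exhausting_def ecc_def by simp
qed

lemma broadcastI:
  assumes "card (pverts G) \<noteq> 1" "f \<in> extensional (pverts G)"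
    and "\<And>v. v \<in> pverts G \<Longrightarrow> f v \<le> ecc G v"
  shows "broadcast G f"
proof -
  have "f v \<le> diam G" if "v \<in> pverts G" for v
    using assms(3)[OF that] ecc_le_diam[OF that] by (rule le_trans)
  then show ?thesis using assms by (simp add: broadcast_def PiE_def)
qed

lemma broadcast_extensional: "broadcast G f \<Longrightarrow> f \<in> extensional (pverts G)"
  unfolding broadcast_def by (auto simp: PiE_def split: if_splits)

lemma broadcast_le_ecc:
  "broadcast G f \<Longrightarrow> card (pverts G) \<noteq> 1 \<Longrightarrow> v \<in> pverts G \<Longrightarrow> f v \<le> ecc G v"
  unfolding broadcast_def by simp

lemma mem_heard_from:
  "v \<in> heard_from G f x \<longleftrightarrow> v \<in> pverts G \<and> 0 < f v \<and> gdist G x v \<le> f v"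
  unfolding heard_from_def broadcasting_def by auto

text \<open>If the bound fails, some vertex on a geodesic hears both ends and lies strictly inside
  one of the balls. Conversely, if \<open>x\<close> hears \<open>u\<close>, the triangle inequality
  through \<open>x\<close> keeps it at distance at least \<open>f w\<close> from every other
  broadcasting \<open>w\<close>.\<close>

lemma bn_independent_iff_packing:
  "bn_independent G f \<longleftrightarrow> broadcast G f \<and> packing (pverts G) (gdist G) f"
proof (intro iffI conjI)
  assume bn: "bn_independent G f"
  then show "broadcast G f" unfolding bn_independent_def by blast
  show "packing (pverts G) (gdist G) f"
    unfolding packing_def
  proof (intro ballI impI, rule ccontr)
    fix u v assume u: "u \<in> pverts G" and v: "v \<in> pverts G" and uv: "u \<noteq> v" "0 < f u" "0 < f v"
      and "\<not> f u + f v \<le> gdist G u v"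
    then have lt: "gdist G u v < f u + f v" by simp
    \<comment> \<open>The minimum covers the case that \<open>f u\<close> exceeds the distance; then
      \<open>z\<close> is \<open>v\<close> itself.\<close>
    define k where "k = min (f u) (gdist G u v)"
    obtain z where z: "z \<in> pverts G" "gdist G u z = k" "gdist G z v = gdist G u v - k"
      using M.between[OF u v, of k] unfolding k_def by auto
    have zv: "gdist G z v < f v" using z(3) lt uv(3) unfolding k_def by linarith
    have "gdist G z u \<le> f u" using z M.dist_commute[OF u z(1)] unfolding k_def by simp
    then have "{u, v} \<subseteq> heard_from G f z" using u v uv zv by (simp add: mem_heard_from)
    moreover have "finite (heard_from G f z)"
      using M.finite by (rule finite_subset[rotated]) (auto simp: mem_heard_from)
    ultimately have "1 < card (heard_from G f z)"
      using card_mono[of "heard_from G f z" "{u, v}"] uv(1) by simp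
    then have "f v \<le> gdist G z v"
      using bn z(1) v uv(3) unfolding bn_independent_def broadcasting_def by blast
    then show False using zv by simp
  qed
next
  assume "broadcast G f \<and> packing (pverts G) (gdist G) f"
  then have b: "broadcast G f"
    and pack: "\<And>u v. u \<in> pverts G \<Longrightarrow> v \<in> pverts G \<Longrightarrow> u \<noteq> v \<Longrightarrow> 0 < f u \<Longrightarrow> 0 < f v \<Longrightarrow>
      f u + f v \<le> gdist G u v"
    unfolding packing_def by auto
  have "f w \<le> gdist G x w"
    if x: "x \<in> pverts G" and card: "1 < card (heard_from G f x)"
      and w: "w \<in> pverts G" "0 < f w" for x w
  proof -
    have "\<not> heard_from G f x \<subseteq> {w}"
      using card card_mono[of "{w}" "heard_from G f x"] by auto
    then obtain u where "u \<in> heard_from G f x" "u \<noteq> w" by blast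
    then have u: "u \<in> pverts G" "0 < f u" "gdist G x u \<le> f u" "u \<noteq> w"
      by (simp_all add: mem_heard_from)
    have "f u + f w \<le> gdist G u w" using pack u w by simp
    also have "\<dots> \<le> gdist G u x + gdist G x w" by (rule M.dist_triangle[OF u(1) x w(1)])
    also have "gdist G u x \<le> f u" using u M.dist_commute[OF u(1) x] by simp
    finally show ?thesis by simp
  qed
  then show "bn_independent G f"
    using b unfolding bn_independent_def broadcasting_def by blast
qed

text \<open>Maximality is tested only by raising one value by one. At a value 0 the obstruction says
  that the vertex hears another one; at a positive value, packing turns it into touching.\<close>

lemma maximal_imp_saturated:
  assumes card: "card (pverts G) \<noteq> 1" and max: "maximal_bn_independent G f"
  shows "saturated (pverts G) (gdist G) f"
proof -
  have bn: "bn_independent G f"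
    and no: "\<And>g. bn_independent G g \<Longrightarrow> g \<noteq> f \<Longrightarrow> \<exists>v\<in>pverts G. \<not> f v \<le> g v"
    using max unfolding maximal_bn_independent_def by auto
  have b: "broadcast G f" and pack: "packing (pverts G) (gdist G) f"
    using bn unfolding bn_independent_iff_packing by auto
  have stuck: "\<exists>u\<in>pverts G. u \<noteq> v \<and> 0 < f u \<and> gdist G u v \<le> f u + f v"
    if v: "v \<in> pverts G" and lt: "f v < ecc G v" for v
  proof (rule ccontr)
    assume none: "\<not> ?thesis"
    define g where "g = f(v := f v + 1)"
    have far: "f u + f v + 1 \<le> gdist G u v" if "u \<in> pverts G" "u \<noteq> v" "0 < f u" for u
      using none that by fastforce
    have "broadcast G g"
    proof (rule broadcastI[OF card])
      show "g \<in> extensional (pverts G)"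
        using broadcast_extensional[OF b] v unfolding g_def extensional_def by auto
      show "g u \<le> ecc G u" if "u \<in> pverts G" for u
        using broadcast_le_ecc[OF b card that] lt unfolding g_def by simp
    qed
    moreover have "packing (pverts G) (gdist G) g"
      unfolding packing_def
    proof (intro ballI impI)
      fix x y assume xy: "x \<in> pverts G" "y \<in> pverts G" "x \<noteq> y" "0 < g x" "0 < g y"
      consider "x = v" | "y = v" | "x \<noteq> v" "y \<noteq> v" by blast
      then show "g x + g y \<le> gdist G x y"
      proof cases
        case 1
        then show ?thesis using far[of y] xy M.dist_commute[OF xy(1,2)] by (simp add: g_def)
      next
        case 2
        then show ?thesis using far[of x] xy by (simp add: g_def)
      next
        case 3
        then show ?thesis using pack xy unfolding packing_def by (simp add: g_def)
      qed
    qed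
    ultimately have "bn_independent G g" by (simp add: bn_independent_iff_packing)
    moreover have "g v \<noteq> f v" by (simp add: g_def)
    ultimately obtain u where "\<not> f u \<le> g u" using no by metis
    then show False by (simp add: g_def split: if_splits)
  qed
  have "dominating (pverts G) (gdist G) f"
    unfolding dominating_def
  proof
    fix x assume x: "x \<in> pverts G"
    show "\<exists>v\<in>pverts G. 0 < f v \<and> gdist G x v \<le> f v"
    proof (cases "f x = 0")
      case True
      obtain y where y: "y \<in> pverts G" "y \<noteq> x"
        using card x by (metis is_singletonI' is_singleton_altdef empty_iff)
      then have "0 < gdist G x y" using M.dist_eq_0_iff x by auto
      then have "f x < ecc G x" using gdist_le_ecc[OF y(1) x] True by simp
      then obtain u where "u \<in> pverts G" "0 < f u" "gdist G u x \<le> f u"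
        using stuck[OF x] True by auto
      then show ?thesis using M.dist_commute x by metis
    next
      case False
      moreover have "gdist G x x = 0" using M.dist_eq_0_iff x by simp
      ultimately show ?thesis using x by (intro bexI[of _ x]) auto
    qed
  qed
  moreover have "touching (pverts G) (gdist G) f v"
    if v: "v \<in> pverts G" "0 < f v" and ne: "\<not> exhausting (pverts G) (gdist G) f v" for v
  proof -
    have "f v < ecc G v"
      using ne broadcast_le_ecc[OF b card v(1)] exhausting_iff_ecc[OF v(1)] by simp
    then obtain u where u: "u \<in> pverts G" "u \<noteq> v" "0 < f u" "gdist G u v \<le> f u + f v"
      using stuck v by blast
    then have "f u + f v \<le> gdist G u v" using pack v unfolding packing_def by blast
    then show ?thesis using u unfolding touching_def by (intro bexI[of _ u]) auto
  qed
  ultimately show ?thesis using pack unfolding saturated_def by blast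
qed

text \<open>A larger packing that exceeds \<open>f\<close> at \<open>v\<close> would break the bound
  between \<open>v\<close> and the vertex dominating or touching it, or else exceed the
  eccentricity. Restricting \<open>f\<close> makes it extensional, as broadcasts are.\<close>

lemma saturated_imp_maximal:
  assumes card: "card (pverts G) \<noteq> 1" and sat: "saturated (pverts G) (gdist G) f"
  shows "maximal_bn_independent G (restrict f (pverts G))"
proof -
  define h where "h = restrict f (pverts G)"
  have h: "h v = f v" if "v \<in> pverts G" for v using that by (simp add: h_def)
  have pack: "packing (pverts G) (gdist G) f" and dom: "dominating (pverts G) (gdist G) f"
    and tight: "\<And>v. v \<in> pverts G \<Longrightarrow> 0 < f v \<Longrightarrow>
      touching (pverts G) (gdist G) f v \<or> f v = ecc G v"
    using sat exhausting_iff_ecc unfolding saturated_def by auto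
  have "broadcast G h"
  proof (rule broadcastI[OF card])
    show "h \<in> extensional (pverts G)" by (simp add: h_def)
    fix v assume v: "v \<in> pverts G"
    have "f v \<le> ecc G v"
    proof (cases "touching (pverts G) (gdist G) f v")
      case True
      then obtain u where u: "u \<in> pverts G" "gdist G u v = f u + f v"
        unfolding touching_def by blast
      then show ?thesis using gdist_le_ecc[OF u(1) v] M.dist_commute[OF u(1) v] by simp
    next
      case False
      then show ?thesis using tight[OF v] by (cases "f v = 0") auto
    qed
    then show "h v \<le> ecc G v" by (simp add: h v)
  qed
  moreover have "packing (pverts G) (gdist G) h"
    using pack h unfolding packing_def by simp
  moreover have "g = h"
    if bn: "bn_independent G g" and ge: "\<forall>v\<in>pverts G. h v \<le> g v" for g
  proof -
    have b: "broadcast G g" and gpack: "packing (pverts G) (gdist G) g"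
      using bn unfolding bn_independent_iff_packing by auto
    have sep: "g u + g v \<le> gdist G u v"
      if u: "u \<in> pverts G" "0 < f u" and v: "v \<in> pverts G" "f v < g v" and "u \<noteq> v" for u v
    proof -
      have "0 < g u" using ge u h by (metis less_le_trans)
      then show ?thesis using gpack u v \<open>u \<noteq> v\<close> unfolding packing_def by simp
    qed
    have ge': "f v \<le> g v" if "v \<in> pverts G" for v using ge h that by simp
    have "g v \<le> f v" if v: "v \<in> pverts G" for v
    proof (rule ccontr)
      assume "\<not> g v \<le> f v"
      then have lt: "f v < g v" by simp
      show False
      proof (cases "f v = 0")
        case True
        obtain u where u: "u \<in> pverts G" "0 < f u" "gdist G v u \<le> f u"
          using dom v unfolding dominating_def by blast
        then have "u \<noteq> v" using True by auto
        then show False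
          using sep[OF u(1,2) v lt] ge'[OF u(1)] lt u M.dist_commute[OF u(1) v] by simp
      next
        case False
        then consider "touching (pverts G) (gdist G) f v" | "f v = ecc G v"
          using tight v by blast
        then show False
        proof cases
          case 1
          then obtain u where u: "u \<in> pverts G" "u \<noteq> v" "0 < f u" "gdist G u v = f u + f v"
            unfolding touching_def by blast
          then show False using sep[OF u(1,3) v lt u(2)] ge'[OF u(1)] lt by simp
        next
          case 2
          then show False using broadcast_le_ecc[OF b card v] lt by simp
        qed
      qed
    qed
    then have "g v = h v" if "v \<in> pverts G" for v
      using ge' h that by (simp add: le_antisym)
    then show ?thesis
      using broadcast_extensional[OF b] extensionalityI[of g "pverts G" h] by (simp add: h_def)
  qed
  ultimately show ?thesis
    unfolding maximal_bn_independent_def h_def[symmetric] bn_independent_iff_packing by blast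
qed

lemma i_bn_le:
  assumes "card (pverts G) \<noteq> 1" "saturated (pverts G) (gdist G) f"
  shows "i_bn G \<le> sum f (pverts G)"
proof -
  have "broadcast_cost G (restrict f (pverts G)) = sum f (pverts G)"
    unfolding broadcast_cost_def by simp
  then show ?thesis
    unfolding i_bn_def using saturated_imp_maximal[OF assms] by (intro Least_le) blast
qed

text \<open>For \<open>LEAST\<close> to be attained some maximal broadcast must exist; one vertex
  broadcasting its eccentricity provides it.\<close>

lemma i_bn_attained:
  assumes card: "card (pverts G) \<noteq> 1"
  shows "\<exists>f. saturated (pverts G) (gdist G) f \<and> sum f (pverts G) = i_bn G"
proof -
  obtain v where v: "v \<in> pverts G" using pverts_nonempty by blast
  have "gdist G u v \<le> ecc G v" if "u \<in> pverts G" for u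
    using gdist_le_ecc[OF that v] M.dist_commute[OF that v] by simp
  then obtain g where "saturated (pverts G) (gdist G) g"
    using M.saturated_single[OF v card] by blast
  then have "\<exists>k f. maximal_bn_independent G f \<and> broadcast_cost G f = k"
    using saturated_imp_maximal[OF card] by blast
  then have "\<exists>f. maximal_bn_independent G f \<and> broadcast_cost G f = i_bn G"
    unfolding i_bn_def by (rule LeastI_ex)
  then show ?thesis
    using maximal_imp_saturated[OF card] unfolding broadcast_cost_def by blast
qed

lemma i_bn_single:
  assumes "pverts G = {v}"
  shows "i_bn G = 1"
proof -
  have b: "broadcast G f \<longleftrightarrow> f = (\<lambda>x\<in>{v}. 1)" for f
    using assms by (auto simp: broadcast_def PiE_singleton)
  have "packing (pverts G) (gdist G) f" for f using assms by (simp add: packing_def)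
  then have "maximal_bn_independent G f \<longleftrightarrow> f = (\<lambda>x\<in>{v}. 1)" for f
    unfolding maximal_bn_independent_def bn_independent_iff_packing b by blast
  then show ?thesis
    unfolding i_bn_def broadcast_cost_def using assms by (simp add: Least_equality)
qed

lemma i_bn_pos: "0 < i_bn G"
proof (cases "card (pverts G) = 1")
  case True
  then show ?thesis using i_bn_single by (auto simp: card_1_singleton_iff)
next
  case False
  obtain f where f: "saturated (pverts G) (gdist G) f" "sum f (pverts G) = i_bn G"
    using i_bn_attained[OF False] by blast
  then obtain v where "v \<in> pverts G" "0 < f v"
    using pverts_nonempty unfolding saturated_def dominating_def by blast
  then have "0 < sum f (pverts G)" using M.finite by (metis gr0I sum_eq_0_iff)
  then show ?thesis using f by simp
qed

end

section \<open>Monotonicity under subtrees\<close>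

lemma tree_graph_if_undirected_tree: "undirected_tree T \<Longrightarrow> tree_graph T"
  unfolding undirected_tree_def tree_graph_def tree_graph_axioms_def connected_pair_graph_def
    connected_pair_graph_axioms_def
  by (meson not_le)

theorem theorem4p2:
  fixes T T' :: "'a pair_pre_digraph"
  assumes "undirected_tree T"
    and "undirected_tree T'"
    and "subgraph (with_proj T') (with_proj T)"
  shows "i_bn T' \<le> i_bn T"
proof -
  interpret T: tree_graph T using assms(1) by (rule tree_graph_if_undirected_tree)
  interpret T': tree_graph T' using assms(2) by (rule tree_graph_if_undirected_tree)
  interpret M: tree_metric "pverts T" "gdist T" by (rule T.tree_metric_gdist)
  have sub: "pverts T' \<subseteq> pverts T" using assms(3) by (simp add: subgraph_def)
  show ?thesis
  proof (cases "card (pverts T') = 1")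
    case True
    \<comment> \<open>On one vertex the only broadcast costs 1, so positivity of
      \<open>i_bn T\<close> suffices.\<close>
    then have "i_bn T' = 1" using T'.i_bn_single by (auto simp: card_1_singleton_iff)
    then show ?thesis using T.i_bn_pos by simp
  next
    case False
    have eq: "gdist T' u v = gdist T u v" if "u \<in> pverts T'" "v \<in> pverts T'" for u v
      using T.gdist_subgraph[OF T'.connected_pair_graph_axioms assms(3) that] .
    have geo: "geodesic_space (pverts T') (gdist T)"
      using T'.geodesic_space_gdist eq by (rule geodesic_space_cong)
    \<comment> \<open>Saturation mentions only distances within the set, so the metric of
      \<open>T\<close> may replace that of \<open>T'\<close>.\<close>
    have sat: "saturated (pverts T') (gdist T') f \<longleftrightarrow> saturated (pverts T') (gdist T) f" for f
      unfolding saturated_def packing_def dominating_def touching_def exhausting_def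
      by (simp add: eq cong: image_cong)
    have "card (pverts T') \<le> card (pverts T)" using sub M.finite by (rule card_mono[rotated])
    moreover have "0 < card (pverts T')"
      using T'.pverts_nonempty sub M.finite finite_subset by (metis card_gt_0_iff)
    ultimately have "card (pverts T) \<noteq> 1" using False by linarith
    then obtain f where f: "saturated (pverts T) (gdist T) f" "sum f (pverts T) = i_bn T"
      using T.i_bn_attained by blast
    obtain g where g: "saturated (pverts T') (gdist T) g" "sum g (pverts T') \<le> i_bn T"
      using M.saturated_restrict[OF geo sub T'.pverts_nonempty False f(1)] f(2) by auto
    show ?thesis using T'.i_bn_le[OF False] g sat by (meson le_trans)
  qed
qed

end
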